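(* Let $G$ be a finite non-abelian group with $|Z(G)| = z \ge 2$ and $G/Z(G) \cong \mathbb{Z}_p \times \mathbb{Z}_p$, where $p$ is a prime. Let $\Gamma_G$ be the commuting conjugacy class graph of $G$. Then $$\text{CNL-spec}(\Gamma_G) = \left\{ (0)^{p+1}, \left(\tfrac{1}{p^2}(pz - z)(pz - z - 2p)\right)^{\frac{p+1}{p}(pz - z - p)} \right\},$$ $$\text{CNSL-spec}(\Gamma_G) = \left\{ \left(\tfrac{2}{p^2}(pz - z - p)(pz - z - 2p)\right)^{p+1}, \left(\tfrac{1}{p^2}(pz - z - 2p)^2\right)^{\frac{p+1}{p}(pz - z - p)} \right\},$$ and $$LE_{CN}(\Gamma_G) = LE^+_{CN}(\Gamma_G) = \begin{cases} \frac{3}{2}, & \text{for } p = 2 \text{ and } z = 3,\\ \frac{4(p-2)(p+1)}{p^2}, & \text{for } p \ge 2 \text{ and } z = 2,\\ \frac{2(p+1)(p(z-2)-z)(p(z-1)-z)}{p^2}, & \text{otherwise.} \end{cases}$$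
   Context: For a finite non-abelian group $G$ with center $Z(G)$, the commuting conjugacy class graph (CCC-graph) $\Gamma_G$ is the simple undirected graph whose vertices are the conjugacy classes $x^G$ of non-central elements $x \in G \setminus Z(G)$; two distinct vertices $x^G, y^G$ are adjacent if there exist $x' \in x^G$ and $y' \in y^G$ with $x'y' = y'x'$. For a finite simple graph $\mathcal{G}$ with vertices $v_1,\dots,v_N$, let $CN(\mathcal{G})$ be the $N\times N$ matrix whose $(i,j)$ entry is, for $i\ne j$, the number of vertices other than $v_i,v_j$ adjacent to both $v_i$ and $v_j$, and whose diagonal entries are $0$. Let $CNRS(\mathcal{G})$ be the diagonal matrix whose $i$-th diagonal entry is the $i$-th row sum of $CN(\mathcal{G})$. Put $CNL(\mathcal{G}) = CNRS(\mathcal{G}) - CN(\mathcal{G})$ and $CNSL(\mathcal{G}) = CNRS(\mathcal{G}) + CN(\mathcal{G})$. CNL-spec$(\mathcal{G})$ and CNSL-spec$(\mathcal{G})$ denote the multisets of eigenvalues of $CNL(\mathcal{G})$ and $CNSL(\mathcal{G})$; $(\alpha)^a$ means eigenvalue $\alpha$ with multiplicity $a$ (an entry with multiplicity $0$ is absent; multiplicities of listed entries with coinciding values are added). Let $\Delta(\mathcal{G}) = \operatorname{tr}(CNRS(\mathcal{G}))/N$. Then $LE_{CN}(\mathcal{G}) = \sum_{\alpha} |\alpha - \Delta(\mathcal{G})|$ over all eigenvalues $\alpha$ of $CNL(\mathcal{G})$ counted with multiplicity, and $LE^+_{CN}(\mathcal{G}) = \sum_{\beta} |\beta - \Delta(\mathcal{G})|$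 over all eigenvalues $\beta$ of $CNSL(\mathcal{G})$ counted with multiplicity. *)

theory Defs
  imports
    "HOL-Algebra.Elementary_Groups"
    "Graph_Theory.Pair_Digraph"
    "Jordan_Normal_Form.Char_Poly"
begin

definition center :: "('a, 'b) monoid_scheme \<Rightarrow> 'a set" where
  "center G = {x \<in> carrier G. \<forall>y\<in>carrier G. x \<otimes>\<^bsub>G\<^esub> y = y \<otimes>\<^bsub>G\<^esub> x}"

definition conj_class :: "('a, 'b) monoid_scheme \<Rightarrow> 'a \<Rightarrow> 'a set" where
  "conj_class G x = {g \<otimes>\<^bsub>G\<^esub> x \<otimes>\<^bsub>G\<^esub> inv\<^bsub>G\<^esub> g | g. g \<in> carrier G}"

text \<open>
  Simple undirected graphs are the loop-free symmetric digraphs of \<^locale>\<open>pair_graph\<close>;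
  an edge between two vertices is represented by both of its orientations.
\<close>

definition CCC_graph :: "('a, 'b) monoid_scheme \<Rightarrow> 'a set pair_pre_digraph" where
  "CCC_graph G =
    (let V = conj_class G ` (carrier G - center G) in
     \<lparr> pverts = V,
       parcs = {(A, B). A \<in> V \<and> B \<in> V \<and> A \<noteq> B \<and>
                  (\<exists>x\<in>A. \<exists>y\<in>B. x \<otimes>\<^bsub>G\<^esub> y = y \<otimes>\<^bsub>G\<^esub> x)} \<rparr>)"

lemma pair_graph_CCC_graph:
  assumes "finite (carrier G)"
  shows "pair_graph (CCC_graph G)"
proof
  show "finite (pverts (CCC_graph G))"
    using assms by (simp add: CCC_graph_def Let_def)
  have "parcs (CCC_graph G) \<subseteq> pverts (CCC_graph G) \<times> pverts (CCC_graph G)"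
    by (auto simp: CCC_graph_def Let_def)
  then show "finite (parcs (CCC_graph G))"
    using \<open>finite (pverts (CCC_graph G))\<close> by (meson finite_SigmaI finite_subset)
  show "symmetric (with_proj (CCC_graph G))"
    unfolding symmetric_def with_proj_simps
    by (rule symI) (auto simp: CCC_graph_def Let_def; metis)
qed (auto simp: CCC_graph_def Let_def)

text \<open>
  The matrices of a graph depend on an enumeration \<open>vs\<close> of its vertices, meant to satisfy
  \<open>distinct vs\<close> and \<open>set vs = pverts H\<close>. Rows and columns are indexed from 0.
\<close>

definition CN :: "'v pair_pre_digraph \<Rightarrow> 'v list \<Rightarrow> real mat" where
  "CN H vs = mat (length vs) (length vs) (\<lambda>(i, j).
     if i = j then 0
     else real (card {w \<in> pverts H. w \<noteq> vs ! i \<and> w \<noteq> vs ! j \<and>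
                        (vs ! i, w) \<in> parcs H \<and> (vs ! j, w) \<in> parcs H}))"

definition CNRS :: "'v pair_pre_digraph \<Rightarrow> 'v list \<Rightarrow> real mat" where
  "CNRS H vs = mat (length vs) (length vs) (\<lambda>(i, j).
     if i = j then \<Sum>k<length vs. CN H vs $$ (i, k) else 0)"

definition CNL :: "'v pair_pre_digraph \<Rightarrow> 'v list \<Rightarrow> real mat" where
  "CNL H vs = CNRS H vs - CN H vs"

definition CNSL :: "'v pair_pre_digraph \<Rightarrow> 'v list \<Rightarrow> real mat" where
  "CNSL H vs = CNRS H vs + CN H vs"

text \<open>
  The eigenvalues of a square matrix with their algebraic multiplicities. Only eigenvalues in
  \<open>\<real>\<close> are collected; for the symmetric matrices \<^const>\<open>CNL\<close> and \<^const>\<open>CNSL\<close> these are all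
  complex eigenvalues, and algebraic and geometric multiplicities agree.
\<close>

definition eigenvalue_mset :: "real mat \<Rightarrow> real multiset" where
  "eigenvalue_mset A = proots (char_poly A)"

definition CNL_spec :: "'v pair_pre_digraph \<Rightarrow> 'v list \<Rightarrow> real multiset" where
  "CNL_spec H vs = eigenvalue_mset (CNL H vs)"

definition CNSL_spec :: "'v pair_pre_digraph \<Rightarrow> 'v list \<Rightarrow> real multiset" where
  "CNSL_spec H vs = eigenvalue_mset (CNSL H vs)"

definition CN_Delta :: "'v pair_pre_digraph \<Rightarrow> 'v list \<Rightarrow> real" where
  "CN_Delta H vs = sum_list (diag_mat (CNRS H vs)) / real (card (pverts H))"

definition LE_CN :: "'v pair_pre_digraph \<Rightarrow> 'v list \<Rightarrow> real" where
  "LE_CN H vs = (\<Sum>\<alpha>\<in>#CNL_spec H vs. \<bar>\<alpha> - CN_Delta H vs\<bar>)"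

definition LE_CN_plus :: "'v pair_pre_digraph \<Rightarrow> 'v list \<Rightarrow> real" where
  "LE_CN_plus H vs = (\<Sum>\<beta>\<in>#CNSL_spec H vs. \<bar>\<beta> - CN_Delta H vs\<bar>)"

end

theory Submission
  imports Defs
begin

text \<open>
  Let \<open>z = |Z(G)|\<close>. Since \<open>|G| = p\<^sup>2 z\<close>, every subgroup strictly between the center and \<open>G\<close> has
  order \<open>p z\<close>. Applied to the centralizers of one and of two commuting elements, this shows that
  commuting noncentral elements have the same centralizer, so \<open>\<Gamma>\<^sub>G\<close> is a disjoint union of cliques
  indexed by the \<open>p + 1\<close> centralizers of noncentral elements. All noncentral classes have size
  \<open>p\<close>, and a class lies inside the centralizer of its members because \<open>G/Z(G)\<close> is commutative;
  hence each clique has \<open>n = (p - 1) z / p\<close> vertices. The matrices are then of the form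
  \<open>a U U\<^sup>T + b I\<close>, where \<open>U\<close> is the vertex-clique incidence matrix and \<open>U\<^sup>T U = n I\<close>, and
  Sylvester's determinant identity gives the characteristic polynomial.
\<close>

section \<open>Determinants of block-structured matrices\<close>

text \<open>Counting by fibres. All counts below rest on it: vertices by clique, group elements by
  conjugate, noncentral elements by centralizer and by class.\<close>

lemma card_eq_mult_card_image:
  assumes "finite A" "\<And>y. y \<in> f ` A \<Longrightarrow> card {x \<in> A. f x = y} = k"
  shows "card A = k * card (f ` A)"
  using sum.image_gen[OF assms(1), of "\<lambda>_. 1::nat" f] assms(2) by simp

text \<open>Both sides are evaluations of the determinant of the block matrix with rows
  \<open>(c I, A)\<close> and \<open>(B, I)\<close>.\<close>

lemma det_smult_one_minus_mult:
  fixes A B :: "'a::idom mat"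
  assumes A: "A \<in> carrier_mat n m" and B: "B \<in> carrier_mat m n"
  shows "c ^ m * det (c \<cdot>\<^sub>m 1\<^sub>m n - A * B) = c ^ n * det (c \<cdot>\<^sub>m 1\<^sub>m m - B * A)"
proof -
  let ?M = "four_block_mat (c \<cdot>\<^sub>m 1\<^sub>m n) A B (1\<^sub>m m)"
  \<comment> \<open>The unipotent \<open>?L\<close> subtracts \<open>A * B\<close> from the upper
    left block and leaves the determinant unchanged.\<close>
  let ?L = "four_block_mat (1\<^sub>m n) (0\<^sub>m n m) (- B) (1\<^sub>m m)"
  \<comment> \<open>\<open>c\<close> need not be a unit, so the right block column is scaled by
    \<open>c\<close> before \<open>A\<close> is cleared; this costs the factor
    \<open>c ^ m\<close>.\<close>
  let ?R = "four_block_mat (1\<^sub>m n) (- A) (0\<^sub>m m n) (c \<cdot>\<^sub>m 1\<^sub>m m)"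
  have cM: "?M \<in> carrier_mat (n + m) (n + m)" and cL: "?L \<in> carrier_mat (n + m) (n + m)"
    and cR: "?R \<in> carrier_mat (n + m) (n + m)"
    using A B by auto
  have "?M * ?L = four_block_mat (c \<cdot>\<^sub>m 1\<^sub>m n - A * B) A (0\<^sub>m m n) (1\<^sub>m m)"
    using A B by (subst mult_four_block_mat[where ?n1.0 = n and ?n2.0 = m])
      (auto intro!: cong_four_block_mat eq_matI)
  moreover have "det \<dots> = det (c \<cdot>\<^sub>m 1\<^sub>m n - A * B)"
    using A B by (subst det_four_block_mat_lower_left_zero[where n = n and m = m]) auto
  moreover have "det ?L = 1"
    using A B by (subst det_four_block_mat_upper_right_zero[where n = n and m = m]) auto
  ultimately have 1: "det ?M = det (c \<cdot>\<^sub>m 1\<^sub>m n - A * B)"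
    using det_mult[OF cM cL] by simp
  have "(c \<cdot>\<^sub>m 1\<^sub>m n) * (- A) = - (c \<cdot>\<^sub>m A)"
    using A by (simp add: mult_smult_assoc_mat[OF one_carrier_mat A])
  moreover have "A * (c \<cdot>\<^sub>m 1\<^sub>m m) = c \<cdot>\<^sub>m A"
    using A by (simp add: mult_smult_distrib[OF A one_carrier_mat])
  ultimately have zero: "(c \<cdot>\<^sub>m 1\<^sub>m n) * (- A) + A * (c \<cdot>\<^sub>m 1\<^sub>m m) = 0\<^sub>m n m"
    using A by simp
  have "?M * ?R = four_block_mat ((c \<cdot>\<^sub>m 1\<^sub>m n) * 1\<^sub>m n + A * 0\<^sub>m m n)
      ((c \<cdot>\<^sub>m 1\<^sub>m n) * (- A) + A * (c \<cdot>\<^sub>m 1\<^sub>m m))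
      (B * 1\<^sub>m n + 1\<^sub>m m * 0\<^sub>m m n) (B * (- A) + 1\<^sub>m m * (c \<cdot>\<^sub>m 1\<^sub>m m))"
    by (rule mult_four_block_mat) (use A B in auto)
  also have "\<dots> = four_block_mat (c \<cdot>\<^sub>m 1\<^sub>m n) (0\<^sub>m n m) B (c \<cdot>\<^sub>m 1\<^sub>m m - B * A)"
    unfolding zero using A B by (auto intro!: cong_four_block_mat eq_matI)
  finally have "?M * ?R = four_block_mat (c \<cdot>\<^sub>m 1\<^sub>m n) (0\<^sub>m n m) B (c \<cdot>\<^sub>m 1\<^sub>m m - B * A)" .
  moreover have "det \<dots> = c ^ n * det (c \<cdot>\<^sub>m 1\<^sub>m m - B * A)"
    using A B by (subst det_four_block_mat_upper_right_zero[where n = n and m = m]) auto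
  moreover have "det ?R = c ^ m"
    using A B by (subst det_four_block_mat_lower_left_zero[where n = n and m = m]) auto
  ultimately have "det ?M * c ^ m = c ^ n * det (c \<cdot>\<^sub>m 1\<^sub>m m - B * A)"
    using det_mult[OF cM cR] by simp
  with 1 show ?thesis by (simp add: mult.commute)
qed

text \<open>The determinant identity is applied over the polynomial ring with
  \<open>c = X - b\<close>. It trades the characteristic matrix for a scalar matrix of size
  \<open>m\<close>, with one row per value of \<open>f\<close>.\<close>

lemma char_poly_uniform_blocks:
  fixes f :: "nat \<Rightarrow> 'k" and a b :: "'a::idom"
  assumes n: "\<And>i. i < N \<Longrightarrow> card {j. j < N \<and> f j = f i} = n" and m: "card (f ` {..<N}) = m"
  shows "char_poly (mat N N (\<lambda>(i, j). (if f i = f j then a else 0) + (if i = j then b else 0)))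
    = [:- b, 1:] ^ (N - m) * [:- (b + of_nat n * a), 1:] ^ m"
    (is "char_poly ?A = _")
proof -
  obtain ks where ks: "set ks = f ` {..<N}" "distinct ks"
    using finite_distinct_list[of "f ` {..<N}"] by auto
  have len: "length ks = m"
    using ks m distinct_card by metis
  have ex1: "\<exists>!k. k < m \<and> f i = ks ! k" if "i < N" for i
    using that ks len by (metis distinct_Ex1 image_eqI lessThan_iff)
  have N: "N = n * m"
    using card_eq_mult_card_image[of "{..<N}" f n] n m by auto
  define c where "c = [:- b, 1:]"
  \<comment> \<open>\<open>U * W\<close> is \<open>a\<close> times the same-block indicator, and
    \<open>W * U\<close> is scalar because every block has \<open>n\<close> elements. With
    \<open>a\<close> placed in \<open>U\<close>, the factor \<open>W\<close> is a plain incidence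
    matrix.\<close>
  define U where "U = mat N m (\<lambda>(i, k). if f i = ks ! k then [:a:] else 0)"
  define W where "W = mat m N (\<lambda>(k, j). if f j = ks ! k then (1::'a poly) else 0)"
  have UW: "U * W = mat N N (\<lambda>(i, j). if f i = f j then [:a:] else 0)"
  proof (rule eq_matI, goal_cases)
    case (1 i j)
    then have ij: "i < N" "j < N" by auto
    from ex1[OF ij(1)] obtain k where k: "k < m" "f i = ks ! k" "\<And>l. l < m \<Longrightarrow> f i = ks ! l \<Longrightarrow> l = k"
      by metis
    have "(U * W) $$ (i, j) = (\<Sum>l = 0..<m. U $$ (i, l) * W $$ (l, j))"
      using ij by (simp add: U_def W_def scalar_prod_def)
    also have "\<dots> = (\<Sum>l = 0..<m. if l = k then (if f i = f j then [:a:] else 0) else 0)"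
      using ij k by (intro sum.cong) (auto simp: U_def W_def)
    finally show ?case
      using ij k(1) by simp
  qed (simp_all add: U_def W_def)
  have WU: "W * U = ([:of_nat n * a:]) \<cdot>\<^sub>m 1\<^sub>m m"
  proof (rule eq_matI, goal_cases)
    case (1 k l)
    then have kl: "k < m" "l < m" by auto
    have eq: "ks ! k = ks ! l \<longleftrightarrow> k = l"
      using kl ks len nth_eq_iff_index_eq by blast
    obtain i where i: "i < N" "f i = ks ! k"
      using kl ks len by (metis imageE lessThan_iff nth_mem)
    have "(W * U) $$ (k, l) = (\<Sum>j = 0..<N. W $$ (k, j) * U $$ (j, l))"
      using kl by (simp add: U_def W_def scalar_prod_def)
    also have "\<dots> = (\<Sum>j = 0..<N. if f j = f i then (if k = l then [:a:] else 0) else 0)"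
      using kl i eq by (intro sum.cong) (auto simp: U_def W_def)
    also have "\<dots> = (\<Sum>j \<in> {j. j < N \<and> f j = f i}. if k = l then [:a:] else 0)"
      by (intro sum.mono_neutral_cong_right) auto
    finally show ?case
      using kl n[OF i(1)] by (simp add: of_nat_poly)
  qed (simp_all add: U_def W_def)
  have "c ^ m * det (c \<cdot>\<^sub>m 1\<^sub>m N - U * W) = c ^ N * det (c \<cdot>\<^sub>m 1\<^sub>m m - W * U)"
    by (rule det_smult_one_minus_mult) (auto simp: U_def W_def)
  moreover have "c \<cdot>\<^sub>m 1\<^sub>m N - U * W = char_poly_matrix ?A"
    unfolding UW by (rule eq_matI) (auto simp: char_poly_matrix_def c_def)
  moreover have "c \<cdot>\<^sub>m 1\<^sub>m m - W * U = [:- (b + of_nat n * a), 1:] \<cdot>\<^sub>m 1\<^sub>m m"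
    unfolding WU by (rule eq_matI) (auto simp: c_def)
  ultimately have eq: "c ^ m * char_poly ?A = c ^ N * [:- (b + of_nat n * a), 1:] ^ m"
    by (simp add: char_poly_def)
  \<comment> \<open>This makes the truncated difference \<open>N - m\<close> exact, so that the
    nonzero factor \<open>c ^ m\<close> can be cancelled.\<close>
  have "m \<le> N"
    using m card_image_le[of "{..<N}" f] by simp
  then have "c ^ N = c ^ m * c ^ (N - m)"
    by (simp flip: power_add)
  with eq have "c ^ m * char_poly ?A = c ^ m * (c ^ (N - m) * [:- (b + of_nat n * a), 1:] ^ m)"
    by (simp add: mult.assoc)
  moreover have "c ^ m \<noteq> 0"
    by (simp add: c_def)
  ultimately show ?thesis
    unfolding c_def using mult_left_cancel by blast
qed

text \<open>The characteristic polynomial splits into linear factors, so \<open>proots\<close>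
  returns every eigenvalue with its multiplicity.\<close>

lemma eigenvalue_mset_uniform_blocks:
  fixes f :: "nat \<Rightarrow> 'k" and a b :: real
  assumes "\<And>i. i < N \<Longrightarrow> card {j. j < N \<and> f j = f i} = n" and "card (f ` {..<N}) = m"
  shows "eigenvalue_mset (mat N N (\<lambda>(i, j). (if f i = f j then a else 0) + (if i = j then b else 0)))
    = replicate_mset m (b + real n * a) + replicate_mset (N - m) b"
  unfolding eigenvalue_mset_def
  by (subst char_poly_uniform_blocks[OF assms])
    (auto simp: proots_mult proots_power add.commute)

section \<open>Disjoint unions of cliques of equal size\<close>

text \<open>The label \<open>f\<close> names the clique of a vertex, so adjacency of distinct
  vertices is equality of labels. For the CCC-graph the label of a class is its centralizer.\<close>

locale uniform_cluster_graph =
  fixes H :: "'v pair_pre_digraph" and f :: "'v \<Rightarrow> 'k" and n m :: nat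
  assumes finite_verts: "finite (pverts H)"
    and arcs: "parcs H = {(A, B). A \<in> pverts H \<and> B \<in> pverts H \<and> A \<noteq> B \<and> f A = f B}"
    and card_cluster: "A \<in> pverts H \<Longrightarrow> card {B \<in> pverts H. f B = f A} = n"
    and card_clusters: "card (f ` pverts H) = m"
begin

lemma card_pverts: "card (pverts H) = n * m"
  using card_eq_mult_card_image[OF finite_verts, of f n] card_cluster card_clusters by auto

context
  fixes vs
  assumes vs: "distinct vs" "set vs = pverts H"
begin

lemma length_vs: "length vs = n * m"
  using vs card_pverts distinct_card by metis

section \<open>Common neighbourhood matrices of a union of cliques\<close>

lemma card_cluster_index:
  assumes "i < length vs"
  shows "card {j. j < length vs \<and> f (vs ! j) = f (vs ! i)} = n"
proof -
  let ?J = "{j. j < length vs \<and> f (vs ! j) = f (vs ! i)}"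
  have "inj_on ((!) vs) ?J"
    using vs(1) by (intro inj_on_nth) auto
  moreover have "(!) vs ` ?J = {B \<in> pverts H. f B = f (vs ! i)}"
    unfolding vs(2)[symmetric] set_conv_nth by blast
  ultimately have "card ?J = card {B \<in> pverts H. f B = f (vs ! i)}"
    using card_image by fastforce
  moreover have "vs ! i \<in> pverts H"
    using assms vs(2) nth_mem by blast
  ultimately show ?thesis
    using card_cluster by simp
qed

lemma image_index: "(\<lambda>i. f (vs ! i)) ` {..<length vs} = f ` pverts H"
  unfolding vs(2)[symmetric] by (force simp: in_set_conv_nth)

text \<open>Two vertices of one clique have the rest of the clique as common neighbours; vertices of
  different cliques have none.\<close>

lemma CN_eq: "CN H vs = mat (length vs) (length vs)
  (\<lambda>(i, j). if i \<noteq> j \<and> f (vs ! i) = f (vs ! j) then real n - 2 else 0)"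
proof (rule eq_matI, goal_cases)
  case (1 i j)
  then have ij: "i < length vs" "j < length vs" by auto
  then have V: "vs ! i \<in> pverts H" "vs ! j \<in> pverts H"
    using vs(2) nth_mem by blast+
  let ?S = "{w \<in> pverts H. w \<noteq> vs ! i \<and> w \<noteq> vs ! j \<and> (vs ! i, w) \<in> parcs H \<and> (vs ! j, w) \<in> parcs H}"
  show ?case
  proof (cases "i \<noteq> j \<and> f (vs ! i) = f (vs ! j)")
    case True
    let ?C = "{B \<in> pverts H. f B = f (vs ! i)}"
    have ne: "vs ! i \<noteq> vs ! j"
      using True ij vs(1) nth_eq_iff_index_eq by blast
    have sub: "{vs ! i, vs ! j} \<subseteq> ?C"
      using True V by auto
    have "?S = ?C - {vs ! i, vs ! j}"
      using True V by (auto simp: arcs)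
    then have "card ?S = n - 2"
      using card_cluster[OF V(1)] sub ne by (simp add: card_Diff_subset)
    \<comment> \<open>The two distinct vertices lie in one clique, so the natural number
      \<open>n - 2\<close> agrees with \<open>real n - 2\<close>.\<close>
    moreover have "2 \<le> n"
      using card_mono[OF _ sub] finite_verts card_cluster[OF V(1)] ne by simp
    ultimately show ?thesis
      using True ij by (simp add: CN_def of_nat_diff)
  next
    case False
    have "CN H vs $$ (i, j) = (if i = j then 0 else real (card ?S))"
      using ij by (simp add: CN_def)
    also have "\<dots> = 0"
    proof (cases "i = j")
      case neq: False
      then have "?S = {}"
        using False by (auto simp: arcs)
      then show ?thesis
        by (simp only: card.empty of_nat_0 if_cancel)
    qed simp
    finally show ?thesis
      using False ij by auto
  qed
qed (simp_all add: CN_def)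

text \<open>A row of \<open>CN H vs\<close> carries the value \<open>real n - 2\<close> at the
  \<open>n - 1\<close> other members of the clique and is zero elsewhere.\<close>

lemma CNRS_eq: "CNRS H vs = mat (length vs) (length vs)
  (\<lambda>(i, j). if i = j then (real n - 1) * (real n - 2) else 0)"
proof (rule eq_matI, goal_cases)
  case (1 i j)
  then have i: "i < length vs" and j: "j < length vs" by auto
  let ?C = "{k. k < length vs \<and> f (vs ! k) = f (vs ! i)}"
  have "(\<Sum>k<length vs. CN H vs $$ (i, k)) = (\<Sum>k\<in>?C - {i}. real n - 2)"
    using i by (intro sum.mono_neutral_cong_right) (auto simp: CN_eq)
  also have "\<dots> = real (n - 1) * (real n - 2)"
    using i card_cluster_index[OF i] by simp
  also have "real (n - 1) = real n - 1"
    using card_cluster_index[OF i] i by (cases n) auto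
  finally show ?case
    using i j by (auto simp: CNRS_def)
qed (simp_all add: CNRS_def)

section \<open>Spectra and energies of a union of cliques\<close>

lemma eigenvalue_mset_clusters:
  fixes a b :: real
  shows "eigenvalue_mset (mat (length vs) (length vs)
      (\<lambda>(i, j). (if f (vs ! i) = f (vs ! j) then a else 0) + (if i = j then b else 0)))
    = replicate_mset m (b + real n * a) + replicate_mset (n * m - m) b"
  using eigenvalue_mset_uniform_blocks[where f = "\<lambda>i. f (vs ! i)", OF card_cluster_index]
  unfolding length_vs[symmetric] image_index using card_clusters by blast

lemma CNL_spec_eq: "CNL_spec H vs = replicate_mset m 0
  + replicate_mset (n * m - m) (real n * (real n - 2))"
proof -
  \<comment> \<open>The block term also contributes \<open>2 - real n\<close> on the diagonal; the
    scalar part \<open>real n * (real n - 2)\<close> compensates for this.\<close>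
  have "CNL H vs = mat (length vs) (length vs) (\<lambda>(i, j).
      (if f (vs ! i) = f (vs ! j) then 2 - real n else 0)
      + (if i = j then real n * (real n - 2) else 0))"
    unfolding CNL_def by (rule eq_matI) (auto simp: CN_eq CNRS_eq algebra_simps)
  moreover have "real n * (real n - 2) + real n * (2 - real n) = 0"
    by (simp add: algebra_simps)
  ultimately show ?thesis
    by (simp only: CNL_spec_def eigenvalue_mset_clusters)
qed

lemma CNSL_spec_eq: "CNSL_spec H vs = replicate_mset m (2 * (real n - 1) * (real n - 2))
  + replicate_mset (n * m - m) ((real n - 2)\<^sup>2)"
proof -
  have "CNSL H vs = mat (length vs) (length vs) (\<lambda>(i, j).
      (if f (vs ! i) = f (vs ! j) then real n - 2 else 0)
      + (if i = j then (real n - 2)\<^sup>2 else 0))"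
    unfolding CNSL_def by (rule eq_matI) (auto simp: CN_eq CNRS_eq algebra_simps power2_eq_square)
  moreover have "(real n - 2)\<^sup>2 + real n * (real n - 2) = 2 * (real n - 1) * (real n - 2)"
    by (simp add: algebra_simps power2_eq_square)
  ultimately show ?thesis
    by (simp only: CNSL_spec_def eigenvalue_mset_clusters)
qed

lemma CN_Delta_eq:
  assumes "n * m > 0"
  shows "CN_Delta H vs = (real n - 1) * (real n - 2)"
proof -
  have "sum_list (diag_mat (CNRS H vs)) = (\<Sum>i<length vs. CNRS H vs $$ (i, i))"
    by (simp add: diag_mat_def sum_list_sum_nth CNRS_def atLeast0LessThan)
  also have "\<dots> = real (n * m) * ((real n - 1) * (real n - 2))"
    by (simp add: CNRS_eq length_vs)
  finally show ?thesis
    using assms by (simp add: CN_Delta_def card_pverts)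
qed

text \<open>In both spectra the deviations from the mean are, up to sign, \<open>n - 2\<close> with
  multiplicity \<open>m (n - 1)\<close> and \<open>(n - 1) (n - 2)\<close> with multiplicity
  \<open>m\<close>. Each group contributes \<open>m (n - 1) |n - 2|\<close>, hence the factor
  2.\<close>

lemma
  assumes "n > 0" "m > 0"
  shows LE_CN_eq: "LE_CN H vs = 2 * real m * (real n - 1) * \<bar>real n - 2\<bar>"
    and LE_CN_plus_eq: "LE_CN_plus H vs = 2 * real m * (real n - 1) * \<bar>real n - 2\<bar>"
proof -
  have \<Delta>: "CN_Delta H vs = (real n - 1) * (real n - 2)"
    using assms by (intro CN_Delta_eq) simp
  have mult: "real (n * m - m) = real m * (real n - 1)"
    using assms by (cases n) (auto simp: algebra_simps)
  have abs: "\<bar>(real n - 1) * (real n - 2)\<bar> = (real n - 1) * \<bar>real n - 2\<bar>"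
    using assms by (simp add: abs_mult)
  have diffs: "real n * (real n - 2) - (real n - 1) * (real n - 2) = real n - 2"
    "2 * (real n - 1) * (real n - 2) - (real n - 1) * (real n - 2) = (real n - 1) * (real n - 2)"
    "(real n - 2)\<^sup>2 - (real n - 1) * (real n - 2) = - (real n - 2)"
    by (simp_all add: algebra_simps power2_eq_square)
  show "LE_CN H vs = 2 * real m * (real n - 1) * \<bar>real n - 2\<bar>"
    unfolding LE_CN_def CNL_spec_eq \<Delta> by (simp add: diffs(1) mult abs)
  show "LE_CN_plus H vs = 2 * real m * (real n - 1) * \<bar>real n - 2\<bar>"
    unfolding LE_CN_plus_def CNSL_spec_eq \<Delta>
    by (simp only: image_mset_union sum_mset.union image_replicate_mset sum_mset_replicate_mset
        diffs(2,3) mult abs abs_minus_cancel)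
qed

end

end

section \<open>Groups whose center has index the square of a prime\<close>

text \<open>Taking a set as argument lets one notion cover a single element, a commuting pair, a
  conjugacy class and, for the whole carrier, the center.\<close>

definition centralizer :: "('a, 'b) monoid_scheme \<Rightarrow> 'a set \<Rightarrow> 'a set" where
  "centralizer G S = {g \<in> carrier G. \<forall>s\<in>S. g \<otimes>\<^bsub>G\<^esub> s = s \<otimes>\<^bsub>G\<^esub> g}"

lemma center_eq_centralizer: "center G = centralizer G (carrier G)"
  by (simp add: center_def centralizer_def)

section \<open>Centralizers and the center\<close>

context group
begin

lemma subgroup_centralizer:
  assumes S: "S \<subseteq> carrier G"
  shows "subgroup (centralizer G S) G"
proof (rule subgroupI)
  show "centralizer G S \<noteq> {}"
    using S by (auto simp: centralizer_def intro!: exI[of _ \<one>])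
  show "inv a \<in> centralizer G S" if "a \<in> centralizer G S" for a
  proof -
    have "inv a \<otimes> s = s \<otimes> inv a" if s: "s \<in> S" for s
    proof -
      have a: "a \<in> carrier G" "s \<in> carrier G" "a \<otimes> s = s \<otimes> a"
        using \<open>a \<in> centralizer G S\<close> s S by (auto simp: centralizer_def)
      then show ?thesis
        by (metis inv_closed inv_solve_left inv_solve_right' m_assoc m_closed)
    qed
    then show ?thesis
      using that by (simp add: centralizer_def)
  qed
  show "a \<otimes> b \<in> centralizer G S" if ab: "a \<in> centralizer G S" "b \<in> centralizer G S" for a b
  proof -
    have "a \<otimes> b \<otimes> s = s \<otimes> (a \<otimes> b)" if s: "s \<in> S" for s
    proof -
      have "a \<in> carrier G" "b \<in> carrier G" "s \<in> carrier G" "a \<otimes> s = s \<otimes> a" "b \<otimes> s = s \<otimes> b"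
        using ab s S by (auto simp: centralizer_def)
      then show ?thesis
        by (metis m_assoc)
    qed
    then show ?thesis
      using ab by (simp add: centralizer_def)
  qed
qed (auto simp: centralizer_def)

lemma center_subset_centralizer: "S \<subseteq> carrier G \<Longrightarrow> center G \<subseteq> centralizer G S"
  by (auto simp: center_def centralizer_def)

lemma centralizer_noncentral_psubset:
  assumes "x \<in> carrier G - center G" and "x \<in> S"
  shows "centralizer G S \<subset> carrier G"
proof -
  obtain y where "y \<in> carrier G" "y \<otimes> x \<noteq> x \<otimes> y"
    using assms(1) by (auto simp: center_def)
  then have "y \<in> carrier G - centralizer G S"
    using assms(2) by (auto simp: centralizer_def)
  then show ?thesis
    by (auto simp: centralizer_def)
qed

lemma normal_center: "center G \<lhd> G"
  unfolding normal_inv_iff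
proof (intro conjI ballI)
  show "subgroup (center G) G"
    by (simp add: center_eq_centralizer subgroup_centralizer)
  fix x h assume "x \<in> carrier G" "h \<in> center G"
  then have "x \<otimes> h \<otimes> inv x = h"
    by (metis (mono_tags, lifting) center_def inv_solve_right' m_closed mem_Collect_eq)
  with \<open>h \<in> center G\<close> show "x \<otimes> h \<otimes> inv x \<in> center G" by simp
qed

section \<open>Conjugacy classes\<close>

lemma self_mem_conj_class: "x \<in> carrier G \<Longrightarrow> x \<in> conj_class G x"
  by (auto simp: conj_class_def intro!: exI[of _ \<one>])

lemma conj_class_eq:
  assumes x: "x \<in> carrier G" and y: "y \<in> conj_class G x"
  shows "conj_class G y = conj_class G x"
proof -
  obtain g where g: "g \<in> carrier G" "y = g \<otimes> x \<otimes> inv g"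
    using y by (auto simp: conj_class_def)
  have "h \<otimes> y \<otimes> inv h = (h \<otimes> g) \<otimes> x \<otimes> inv (h \<otimes> g)" if "h \<in> carrier G" for h
    using that g x by (simp add: inv_mult_group m_assoc)
  moreover have "h \<otimes> x \<otimes> inv h = (h \<otimes> inv g) \<otimes> y \<otimes> inv (h \<otimes> inv g)" if "h \<in> carrier G" for h
  proof -
    have "inv g \<otimes> (g \<otimes> (x \<otimes> (inv g \<otimes> (g \<otimes> inv h)))) = x \<otimes> inv h"
      using that g x by (simp flip: m_assoc)
    then show ?thesis
      using that g x by (simp add: inv_mult_group m_assoc)
  qed
  ultimately show ?thesis
    using g(1) unfolding conj_class_def by (blast intro: m_closed inv_closed)
qed

lemma conj_class_center:
  assumes "x \<in> center G"
  shows "conj_class G x = {x}"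
proof -
  have "g \<otimes> x \<otimes> inv g = x" if "g \<in> carrier G" for g
    using assms that by (metis (mono_tags, lifting) center_def inv_solve_right' m_closed mem_Collect_eq)
  then have "conj_class G x \<subseteq> {x}"
    by (auto simp: conj_class_def)
  moreover have "x \<in> conj_class G x"
    using assms self_mem_conj_class by (simp add: center_def)
  ultimately show ?thesis by auto
qed

text \<open>A central conjugate would form a class by itself and hence equal
  \<open>x\<close>.\<close>

lemma conj_class_noncentral:
  assumes "x \<in> carrier G - center G" and "y \<in> conj_class G x"
  shows "y \<in> carrier G - center G"
proof -
  have "y \<in> carrier G"
    using assms by (auto simp: conj_class_def)
  moreover have "y \<notin> center G"
  proof
    assume "y \<in> center G"
    then have "conj_class G x = {y}"
      using assms conj_class_eq[of x y] conj_class_center[of y] by simp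
    then have "x = y"
      using assms self_mem_conj_class[of x] by simp
    with \<open>y \<in> center G\<close> show False
      using assms by simp
  qed
  ultimately show ?thesis by simp
qed

text \<open>Orbit-stabilizer: the fibre of conjugation over the conjugate of \<open>x\<close> by
  \<open>h\<close> is the left coset of the centralizer by \<open>h\<close>.\<close>

lemma card_centralizer_mult_card_conj_class:
  assumes fin: "finite (carrier G)" and x: "x \<in> carrier G"
  shows "card (centralizer G {x}) * card (conj_class G x) = Coset.order G"
proof -
  let ?f = "\<lambda>g. g \<otimes> x \<otimes> inv g"
  have "card {g \<in> carrier G. ?f g = y} = card (centralizer G {x})" if "y \<in> ?f ` carrier G" for y
  proof -
    from that obtain h where h: "h \<in> carrier G" "y = ?f h" by auto
    have "?f g = y \<longleftrightarrow> inv h \<otimes> g \<in> centralizer G {x}" if g: "g \<in> carrier G" for g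
    proof -
      have "?f g = y \<longleftrightarrow> g \<otimes> x = h \<otimes> x \<otimes> inv h \<otimes> g"
        using h g x by (simp add: inv_solve_right')
      also have "\<dots> \<longleftrightarrow> g \<otimes> x = h \<otimes> (x \<otimes> (inv h \<otimes> g))"
        using h g x by (simp add: m_assoc)
      also have "\<dots> \<longleftrightarrow> inv h \<otimes> (g \<otimes> x) = x \<otimes> (inv h \<otimes> g)"
        using h g x by (metis inv_closed inv_solve_left m_closed)
      finally show ?thesis
        using h g x by (simp add: centralizer_def m_assoc)
    qed
    then have "bij_betw ((\<otimes>) h) (centralizer G {x}) {g \<in> carrier G. ?f g = y}"
      using h by (intro bij_betw_byWitness[where f' = "(\<otimes>) (inv h)"])
        (auto simp: centralizer_def simp flip: m_assoc)
    then show ?thesis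
      by (simp add: bij_betw_same_card)
  qed
  then have "card (carrier G) = card (centralizer G {x}) * card (?f ` carrier G)"
    by (intro card_eq_mult_card_image[OF fin]) auto
  moreover have "?f ` carrier G = conj_class G x"
    by (auto simp: conj_class_def)
  ultimately show ?thesis
    by (simp add: Coset.order_def)
qed

end

text \<open>Two consequences of the quotient isomorphism are kept: the index of the center, and
  commutativity of the quotient, phrased with elements as commutation up to a central
  factor.\<close>

locale center_index_prime_square = group +
  fixes p :: nat
  assumes fin: "finite (carrier G)"
    and prime: "prime p"
    and order: "Coset.order G = p\<^sup>2 * card (center G)"
    and commute_mod_center:
      "\<lbrakk>x \<in> carrier G; y \<in> carrier G\<rbrakk> \<Longrightarrow> \<exists>c\<in>center G. x \<otimes> y = c \<otimes> (y \<otimes> x)"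
begin

lemma card_center_pos: "card (center G) > 0"
proof -
  have "\<one> \<in> center G"
    by (simp add: center_def)
  then show ?thesis
    using fin by (auto simp: card_gt_0_iff center_def)
qed

text \<open>By Lagrange in \<open>H\<close> and in \<open>G\<close>, the index of the center in
  \<open>H\<close> divides \<open>p\<^sup>2\<close>; the strict inclusions exclude 1 and
  \<open>p\<^sup>2\<close>.\<close>

lemma card_intermediate_subgroup:
  assumes H: "subgroup H G" and "center G \<subset> H" "H \<subset> carrier G"
  shows "card H = p * card (center G)"
proof -
  let ?z = "card (center G)"
  have "subgroup (center G) (G\<lparr>carrier := H\<rparr>)"
    using assms normal_center by (intro subgroup_incl) (auto simp: normal_imp_subgroup)
  then have "card (rcosets\<^bsub>G\<lparr>carrier := H\<rparr>\<^esub> center G) * ?z = card H"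
    using group.lagrange[OF subgroup_imp_group[OF H]] by (simp add: Coset.order_def)
  then have "?z dvd card H"
    using dvd_triv_right by metis
  then obtain k where k: "card H = k * ?z"
    by (metis dvdE mult.commute)
  have "card H dvd Coset.order G"
    using lagrange[OF H] by (metis dvd_triv_right)
  then have "k dvd p\<^sup>2"
    using k order card_center_pos by simp
  then obtain i where i: "i \<le> 2" "k = p ^ i"
    using prime by (auto simp: divides_primepow_nat)
  have finH: "finite H"
    using assms fin by (auto intro: finite_subset)
  have "?z < card H" "card H < Coset.order G"
    using assms psubset_card_mono finH fin by (auto simp: Coset.order_def)
  then have "k \<noteq> 1" "k \<noteq> p\<^sup>2"
    using k order by auto
  then have "i = 1"
    using i by (cases "i = 0"; cases "i = 2") auto
  then show ?thesis
    using i k by simp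
qed

lemma card_centralizer:
  assumes x: "x \<in> carrier G - center G"
  shows "card (centralizer G {x}) = p * card (center G)"
proof (rule card_intermediate_subgroup)
  show "subgroup (centralizer G {x}) G"
    using x by (intro subgroup_centralizer) auto
  have "x \<in> centralizer G {x}"
    using x by (simp add: centralizer_def)
  then show "center G \<subset> centralizer G {x}"
    using x center_subset_centralizer[of "{x}"] by auto
  show "centralizer G {x} \<subset> carrier G"
    using x by (intro centralizer_noncentral_psubset[of x]) auto
qed

text \<open>\<open>centralizer G {x, y}\<close> also lies strictly between the center and \<open>G\<close>, so it has the same
  cardinality as \<open>centralizer G {x}\<close>.\<close>

lemma centralizer_eq:
  assumes x: "x \<in> carrier G - center G" and y: "y \<in> carrier G - center G"
    and comm: "x \<otimes> y = y \<otimes> x"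
  shows "centralizer G {x} = centralizer G {y}"
proof -
  have *: "centralizer G {x, y} = centralizer G {v}" if v: "v \<in> {x, y}" for v
  proof (rule card_subset_eq)
    have "card (centralizer G {x, y}) = p * card (center G)"
    proof (rule card_intermediate_subgroup)
      show "subgroup (centralizer G {x, y}) G"
        using x y by (intro subgroup_centralizer) auto
      have "x \<in> centralizer G {x, y}"
        using x comm by (simp add: centralizer_def)
      then show "center G \<subset> centralizer G {x, y}"
        using x y center_subset_centralizer[of "{x, y}"] by auto
      show "centralizer G {x, y} \<subset> carrier G"
        using x by (intro centralizer_noncentral_psubset[of x]) auto
    qed
    then show "card (centralizer G {x, y}) = card (centralizer G {v})"
      using card_centralizer x y v by auto
    show "finite (centralizer G {v})"
      using fin by (simp add: centralizer_def)
    show "centralizer G {x, y} \<subseteq> centralizer G {v}"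
      using v by (auto simp: centralizer_def)
  qed
  show ?thesis
    using *[of x] *[of y] by simp
qed

text \<open>A conjugate of \<open>x\<close> has the form \<open>c \<otimes> x\<close> with
  \<open>c\<close> central, so it commutes with \<open>x\<close>.\<close>

lemma conj_class_subset_centralizer:
  assumes x: "x \<in> carrier G"
  shows "conj_class G x \<subseteq> centralizer G {x}"
proof
  fix y assume "y \<in> conj_class G x"
  then obtain g where g: "g \<in> carrier G" "y = g \<otimes> x \<otimes> inv g"
    by (auto simp: conj_class_def)
  obtain c where c: "c \<in> center G" "g \<otimes> x = c \<otimes> (x \<otimes> g)"
    using commute_mod_center[OF g(1) x] by auto
  then have cc: "c \<in> carrier G" "x \<otimes> c = c \<otimes> x"
    using x by (auto simp: center_def)
  have "y = c \<otimes> x"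
    using g c cc x by (simp add: m_assoc)
  then show "y \<in> centralizer G {x}"
    using cc x by (simp add: centralizer_def m_assoc[symmetric])
qed

text \<open>All members of the class are noncentral and commute with \<open>x\<close>, so they share
  its centralizer. A vertex label can therefore be computed from any representative.\<close>

lemma centralizer_conj_class:
  assumes x: "x \<in> carrier G - center G"
  shows "centralizer G (conj_class G x) = centralizer G {x}"
proof -
  have "centralizer G {y} = centralizer G {x}" if "y \<in> conj_class G x" for y
    using that x conj_class_subset_centralizer conj_class_noncentral[OF x that]
    by (intro centralizer_eq) (auto simp: centralizer_def)
  moreover have "x \<in> conj_class G x"
    using x self_mem_conj_class by simp
  ultimately show ?thesis
    unfolding centralizer_def by blast
qed

section \<open>Counting classes and centralizers\<close>

lemma card_conj_class:
  assumes x: "x \<in> carrier G - center G"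
  shows "card (conj_class G x) = p"
proof -
  have "p * card (center G) * card (conj_class G x) = p * card (center G) * p"
    using card_centralizer_mult_card_conj_class[OF fin, of x] card_centralizer[OF x] x order
    by (auto simp: power2_eq_square)
  moreover have "p * card (center G) > 0"
    using card_center_pos prime_gt_0_nat[OF prime] by simp
  ultimately show ?thesis
    by auto
qed

lemma centralizer_eq_iff:
  assumes "x \<in> carrier G - center G" "y \<in> carrier G - center G"
  shows "centralizer G {y} = centralizer G {x} \<longleftrightarrow> y \<in> centralizer G {x}"
proof
  assume "centralizer G {y} = centralizer G {x}"
  then show "y \<in> centralizer G {x}"
    using assms by (auto simp: centralizer_def)
next
  assume "y \<in> centralizer G {x}"
  then show "centralizer G {y} = centralizer G {x}"
    using assms by (intro centralizer_eq) (auto simp: centralizer_def)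
qed

lemma card_centralizer_minus_center:
  assumes x: "x \<in> carrier G - center G"
  shows "card (centralizer G {x} - center G) = (p - 1) * card (center G)"
proof -
  have "center G \<subseteq> centralizer G {x}" "finite (center G)"
    using x fin center_subset_centralizer[of "{x}"] by (auto simp: center_def)
  then show ?thesis
    using card_centralizer[OF x] by (simp add: card_Diff_subset diff_mult_distrib)
qed

text \<open>The noncentral elements with a given centralizer \<open>K\<close> are exactly those in
  \<open>K\<close>, namely \<open>(p - 1) z\<close> of the \<open>(p\<^sup>2 - 1) z\<close>
  noncentral elements, where \<open>z\<close> is the order of the center.\<close>

lemma card_centralizers: "card ((\<lambda>x. centralizer G {x}) ` (carrier G - center G)) = p + 1"
proof -
  let ?z = "card (center G)"
  have p: "p > 1"
    using prime prime_gt_1_nat by blast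
  have "card {x \<in> carrier G - center G. centralizer G {x} = K} = (p - 1) * ?z"
    if "K \<in> (\<lambda>x. centralizer G {x}) ` (carrier G - center G)" for K
  proof -
    from that obtain x where x: "x \<in> carrier G - center G" "K = centralizer G {x}" by auto
    have "{y \<in> carrier G - center G. centralizer G {y} = K} = K - center G"
      using x centralizer_eq_iff by (auto simp: centralizer_def)
    then show ?thesis
      using card_centralizer_minus_center x by simp
  qed
  then have "card (carrier G - center G)
      = (p - 1) * ?z * card ((\<lambda>x. centralizer G {x}) ` (carrier G - center G))"
    using fin by (intro card_eq_mult_card_image) auto
  moreover have "card (carrier G - center G) = p\<^sup>2 * ?z - ?z"
    using order fin by (subst card_Diff_subset) (auto simp: Coset.order_def center_def)
  moreover have "p\<^sup>2 * ?z - ?z = (p - 1) * ?z * (p + 1)"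
    using p by (cases p) (auto simp: power2_eq_square algebra_simps)
  moreover have "(p - 1) * ?z > 0"
    using p card_center_pos by simp
  ultimately show ?thesis
    by (metis mult_left_cancel less_not_refl2)
qed

text \<open>The noncentral part of a centralizer is a union of whole classes, so the class map on it
  is \<open>p\<close>-to-one.\<close>

lemma card_conj_classes_in_centralizer:
  assumes x: "x \<in> carrier G - center G"
  shows "p * card (conj_class G ` (centralizer G {x} - center G)) = (p - 1) * card (center G)"
proof -
  let ?D = "centralizer G {x} - center G"
  have sub: "?D \<subseteq> carrier G - center G"
    by (auto simp: centralizer_def)
  have "card {y \<in> ?D. conj_class G y = A} = p" if "A \<in> conj_class G ` ?D" for A
  proof -
    from that obtain y where y: "y \<in> ?D" "A = conj_class G y" by auto
    have y': "y \<in> carrier G - center G"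
      using y sub by auto
    have "A \<subseteq> centralizer G {x}"
      using conj_class_subset_centralizer[of y] centralizer_eq_iff[OF x y'] y y' by simp
    moreover have "w \<in> carrier G - center G" "conj_class G w = A" if "w \<in> A" for w
      using that conj_class_noncentral[OF y'] conj_class_eq[of y w] y' y(2) by auto
    moreover have "w \<in> A" if "w \<in> ?D" "conj_class G w = A" for w
      using that sub self_mem_conj_class[of w] by auto
    ultimately have "{w \<in> ?D. conj_class G w = A} = A"
      by blast
    then show ?thesis
      using card_conj_class y y' by simp
  qed
  then have "card ?D = p * card (conj_class G ` ?D)"
    using fin by (intro card_eq_mult_card_image) (auto simp: centralizer_def)
  then show ?thesis
    using card_centralizer_minus_center[OF x] by simp
qed

lemma uniform_cluster_graph_CCC_graph:
  "uniform_cluster_graph (CCC_graph G) (centralizer G) ((p - 1) * card (center G) div p) (p + 1)"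
proof
  let ?V = "conj_class G ` (carrier G - center G)"
  have V: "pverts (CCC_graph G) = ?V"
    by (simp add: CCC_graph_def)
  show "finite (pverts (CCC_graph G))"
    using fin V by simp
  have rep: "x \<in> carrier G - center G \<and> A = conj_class G x" if "A \<in> ?V" "x \<in> A" for A x
  proof -
    from that(1) obtain w where w: "w \<in> carrier G - center G" "A = conj_class G w" by auto
    then show ?thesis
      using that(2) conj_class_noncentral[OF w(1)] conj_class_eq[of w x] by simp
  qed
  \<comment> \<open>Commuting noncentral elements share a centralizer; conversely, equal labels make
    any two representatives commute.\<close>
  have "(\<exists>x\<in>A. \<exists>y\<in>B. x \<otimes> y = y \<otimes> x) \<longleftrightarrow> centralizer G A = centralizer G B"
    if AB: "A \<in> ?V" "B \<in> ?V" for A B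
  proof
    assume "\<exists>x\<in>A. \<exists>y\<in>B. x \<otimes> y = y \<otimes> x"
    then obtain x y where xy: "x \<in> A" "y \<in> B" "x \<otimes> y = y \<otimes> x" by auto
    have x: "x \<in> carrier G - center G" "A = conj_class G x"
      using rep[OF AB(1) xy(1)] by auto
    have y: "y \<in> carrier G - center G" "B = conj_class G y"
      using rep[OF AB(2) xy(2)] by auto
    show "centralizer G A = centralizer G B"
      unfolding x(2) y(2) centralizer_conj_class[OF x(1)] centralizer_conj_class[OF y(1)]
      by (rule centralizer_eq[OF x(1) y(1) xy(3)])
  next
    assume eq: "centralizer G A = centralizer G B"
    obtain x y where xy: "x \<in> carrier G - center G" "y \<in> carrier G - center G"
      "A = conj_class G x" "B = conj_class G y"
      using AB by auto
    then have "centralizer G {x} = centralizer G {y}"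
      using eq centralizer_conj_class by metis
    then have "x \<in> centralizer G {y}"
      using centralizer_eq_iff[OF xy(2,1)] by simp
    then have "x \<otimes> y = y \<otimes> x"
      by (simp add: centralizer_def)
    moreover have "x \<in> A" "y \<in> B"
      using xy self_mem_conj_class by simp_all
    ultimately show "\<exists>x\<in>A. \<exists>y\<in>B. x \<otimes> y = y \<otimes> x"
      by blast
  qed
  then show "parcs (CCC_graph G) = {(A, B). A \<in> pverts (CCC_graph G) \<and> B \<in> pverts (CCC_graph G)
      \<and> A \<noteq> B \<and> centralizer G A = centralizer G B}"
    by (auto simp: CCC_graph_def Let_def)
  have "centralizer G ` ?V = (\<lambda>x. centralizer G {x}) ` (carrier G - center G)"
    unfolding image_image using centralizer_conj_class by (intro image_cong) auto
  then show "card (centralizer G ` pverts (CCC_graph G)) = p + 1"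
    using V card_centralizers by simp
  fix A assume "A \<in> pverts (CCC_graph G)"
  then obtain x where x: "x \<in> carrier G - center G" "A = conj_class G x"
    using V by auto
  have *: "centralizer G (conj_class G y) = centralizer G A \<longleftrightarrow> y \<in> centralizer G {x}"
    if "y \<in> carrier G - center G" for y
    unfolding x(2) centralizer_conj_class[OF x(1)] centralizer_conj_class[OF that]
    by (rule centralizer_eq_iff[OF x(1) that])
  have "centralizer G {x} \<subseteq> carrier G"
    by (auto simp: centralizer_def)
  \<comment> \<open>The clique of \<open>A\<close> consists of the classes of the noncentral
    elements of one centralizer. Their number times \<open>p\<close> is
    \<open>(p - 1) * card (center G)\<close>, so the division by \<open>p\<close> is exact.\<close>
  then have "{B \<in> ?V. centralizer G B = centralizer G A} = conj_class G ` (centralizer G {x} - center G)"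
    using * by blast
  then show "card {B \<in> pverts (CCC_graph G). centralizer G B = centralizer G A}
      = (p - 1) * card (center G) div p"
    using card_conj_classes_in_centralizer[OF x(1)] prime_gt_0_nat[OF prime] V
    by (metis div_mult_self1_is_m)
qed

text \<open>\<open>p\<close> divides \<open>(p - 1) * card (center G)\<close> by the class count but
  is coprime to \<open>p - 1\<close>. This settles the small cases of the energy formula.\<close>

lemma p_dvd_card_center: "p dvd card (center G)"
proof -
  have "carrier G - center G \<noteq> {}"
    using card_centralizers by (metis card.empty image_empty add_is_0 zero_neq_one)
  then obtain x where "x \<in> carrier G - center G" by blast
  then have "p dvd (p - 1) * card (center G)"
    using card_conj_classes_in_centralizer by (metis dvd_triv_left)
  moreover have "\<not> p dvd p - 1"
    using prime_gt_1_nat[OF prime] by (simp add: nat_dvd_not_less)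
  ultimately show ?thesis
    using prime prime_dvd_mult_iff by blast
qed

end

lemma (in group) center_index_prime_square_if_quotient_iso:
  assumes fin: "finite (carrier G)" and p: "prime p"
    and iso: "G Mod center G \<cong> integer_mod_group p \<times>\<times> integer_mod_group p"
  shows "center_index_prime_square G p"
proof -
  interpret Z: normal "center G" G
    by (rule normal_center)
  let ?P = "integer_mod_group p \<times>\<times> integer_mod_group p"
  have "card (carrier (G Mod center G)) = p\<^sup>2"
    using iso_same_card[OF iso] prime_gt_0_nat[OF p]
    by (simp add: carrier_integer_mod_group card_cartesian_product power2_eq_square)
  then have order: "Coset.order G = p\<^sup>2 * card (center G)"
    using lagrange[OF Z.subgroup_axioms] by (simp add: FactGroup_def)
  obtain \<phi> where \<phi>: "\<phi> \<in> hom (G Mod center G) ?P" "inj_on \<phi> (carrier (G Mod center G))"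
    using iso by (auto simp: is_iso_def iso_iff)
  \<comment> \<open>Both components multiply by modular addition, which commutes for arbitrary
    integers; carrier membership need not be tracked.\<close>
  have comm: "u \<otimes>\<^bsub>?P\<^esub> v = v \<otimes>\<^bsub>?P\<^esub> u" for u v
    by (cases u; cases v) (simp add: add.commute)
  have "\<exists>c\<in>center G. x \<otimes> y = c \<otimes> (y \<otimes> x)" if xy: "x \<in> carrier G" "y \<in> carrier G" for x y
  proof -
    let ?X = "center G #> x" and ?Y = "center G #> y"
    have XY: "?X \<in> carrier (G Mod center G)" "?Y \<in> carrier (G Mod center G)"
      using xy by (auto simp: carrier_FactGroup)
    interpret Q: group "G Mod center G"
      by (rule Z.factorgroup_is_group)
    have "\<phi> (?X \<otimes>\<^bsub>G Mod center G\<^esub> ?Y) = \<phi> (?Y \<otimes>\<^bsub>G Mod center G\<^esub> ?X)"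
      unfolding hom_mult[OF \<phi>(1) XY] hom_mult[OF \<phi>(1) XY(2,1)] by (rule comm)
    then have "?X \<otimes>\<^bsub>G Mod center G\<^esub> ?Y = ?Y \<otimes>\<^bsub>G Mod center G\<^esub> ?X"
      using inj_onD[OF \<phi>(2) _ Q.m_closed[OF XY] Q.m_closed[OF XY(2,1)]] by blast
    then have "center G #> (x \<otimes> y) = center G #> (y \<otimes> x)"
      using xy by (simp add: Z.rcos_sum)
    then have "x \<otimes> y \<in> center G #> (y \<otimes> x)"
      using xy rcos_self[OF _ Z.subgroup_axioms, of "x \<otimes> y"] by simp
    then show ?thesis
      by (auto simp: r_coset_def)
  qed
  then show ?thesis
    using fin p order by unfold_locales
qed

section \<open>The spectra\<close>

theorem theorem2p2:
  fixes G :: "('a, 'b) monoid_scheme"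
    and p z :: nat
    and vs :: "'a set list"
  assumes "group G"
    and "finite (carrier G)"
    and "\<not> comm_group G"
    and "card (center G) = z"
    and "z \<ge> 2"
    and "prime p"
    and "G Mod center G \<cong> integer_mod_group p \<times>\<times> integer_mod_group p"
    and "distinct vs"
    and "set vs = pverts (CCC_graph G)"
  shows "(\<exists>a::nat.
            real a = (real p + 1) / real p * (real p * real z - real z - real p) \<and>
            CNL_spec (CCC_graph G) vs =
              replicate_mset (p + 1) 0 +
              replicate_mset a
                (1 / (real p)^2 * (real p * real z - real z)
                  * (real p * real z - real z - 2 * real p)) \<and>
            CNSL_spec (CCC_graph G) vs =
              replicate_mset (p + 1)
                (2 / (real p)^2 * (real p * real z - real z - real p)
                  * (real p * real z - real z - 2 * real p)) +
              replicate_mset a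
                (1 / (real p)^2 * (real p * real z - real z - 2 * real p)^2)) \<and>
         LE_CN (CCC_graph G) vs = LE_CN_plus (CCC_graph G) vs \<and>
         LE_CN_plus (CCC_graph G) vs =
           (if p = 2 \<and> z = 3 then 3 / 2
            else if p \<ge> 2 \<and> z = 2 then 4 * (real p - 2) * (real p + 1) / (real p)^2
            else 2 * (real p + 1) * (real p * (real z - 2) - real z)
                   * (real p * (real z - 1) - real z) / (real p)^2)"
proof -
  interpret group G
    by (rule assms(1))
  interpret center_index_prime_square G p
    by (rule center_index_prime_square_if_quotient_iso) (use assms in auto)
  obtain k where k: "z = p * k"
    using p_dvd_card_center assms(4) by blast
  \<comment> \<open>This is the clique size, that is \<open>(p - 1) z / p\<close> with
    \<open>z = p * k\<close>.\<close>
  define n where "n = (p - 1) * k"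
  have p: "p \<ge> 2"
    using prime prime_ge_2_nat by blast
  have k_pos: "k > 0"
    using k assms(5) by (cases k) auto
  have n_pos: "n > 0"
    using p k_pos by (simp add: n_def)
  have "(p - 1) * card (center G) div p = n"
    using p k assms(4) by (simp add: n_def)
  then interpret uniform_cluster_graph "CCC_graph G" "centralizer G" n "p + 1"
    using uniform_cluster_graph_CCC_graph by simp
  have pn: "real p * real z - real z = real p * real n"
    using p by (simp add: k n_def of_nat_diff algebra_simps)
  \<comment> \<open>Every factor of the claimed formulas is \<open>p\<close> times
    \<open>n - 1\<close> or \<open>n - 2\<close>, so the powers of \<open>p\<close> cancel.\<close>
  have factors: "real p * real z - real z - real p = real p * (real n - 1)"
    "real p * real z - real z - 2 * real p = real p * (real n - 2)"
    "real p * (real z - 2) - real z = real p * (real n - 2)"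
    "real p * (real z - 1) - real z = real p * (real n - 1)"
    using pn by (simp_all add: algebra_simps)
  note vs = assms(8,9)
  let ?a = "n * (p + 1) - (p + 1)"
  have a: "real ?a = (real p + 1) / real p * (real p * real z - real z - real p)"
    unfolding factors using p n_pos by (cases n) (auto simp: field_simps)
  have CNL: "CNL_spec (CCC_graph G) vs = replicate_mset (p + 1) 0 + replicate_mset ?a
      (1 / (real p)^2 * (real p * real z - real z) * (real p * real z - real z - 2 * real p))"
  proof -
    have "1 / (real p)^2 * (real p * real z - real z) * (real p * real z - real z - 2 * real p)
        = real n * (real n - 2)"
      unfolding factors unfolding pn using p by (simp add: power2_eq_square)
    then show ?thesis
      by (simp only: CNL_spec_eq[OF vs])
  qed
  have CNSL: "CNSL_spec (CCC_graph G) vs = replicate_mset (p + 1)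
      (2 / (real p)^2 * (real p * real z - real z - real p) * (real p * real z - real z - 2 * real p))
      + replicate_mset ?a (1 / (real p)^2 * (real p * real z - real z - 2 * real p)^2)"
  proof -
    have "2 / (real p)^2 * (real p * real z - real z - real p) * (real p * real z - real z - 2 * real p)
        = 2 * (real n - 1) * (real n - 2)"
      unfolding factors using p by (simp add: power2_eq_square)
    moreover have "1 / (real p)^2 * (real p * real z - real z - 2 * real p)^2 = (real n - 2)^2"
      unfolding factors using p by (simp add: power_mult_distrib)
    ultimately show ?thesis
      by (simp only: CNSL_spec_eq[OF vs])
  qed
  have "LE_CN_plus (CCC_graph G) vs =
      (if p = 2 \<and> z = 3 then 3 / 2
       else if p \<ge> 2 \<and> z = 2 then 4 * (real p - 2) * (real p + 1) / (real p)^2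
       else 2 * (real p + 1) * (real p * (real z - 2) - real z)
              * (real p * (real z - 1) - real z) / (real p)^2)"
  \<comment> \<open>For \<open>z = 2\<close> divisibility forces \<open>p = 2\<close> and
    \<open>n = 1\<close>; both sides are then 0.\<close>
  proof (cases "z = 2")
    case True
    then have "p dvd 2"
      using k dvd_triv_left by metis
    then have "p = 2"
      using p dvd_imp_le[of p 2] by simp
    moreover from this have "n = 1"
      using True k by (simp add: n_def)
    ultimately show ?thesis
      using True LE_CN_plus_eq[OF vs] by simp
  next
    case False
    have not_3: "\<not> (p = 2 \<and> z = 3)"
      using k by clarify presburger
    have "n \<noteq> 1"
      using False k p by (auto simp: n_def)
    then have "\<bar>real n - 2\<bar> = real n - 2"
      using n_pos by simp
    then have "LE_CN_plus (CCC_graph G) vs = 2 * (real p + 1) * (real n - 1) * (real n - 2)"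
      using LE_CN_plus_eq[OF vs n_pos] by simp
    also have "\<dots> = 2 * (real p + 1) * (real p * (real z - 2) - real z)
        * (real p * (real z - 1) - real z) / (real p)^2"
      unfolding factors using p by (simp add: power2_eq_square)
    finally show ?thesis
      using False not_3 by (simp only: if_False simp_thms)
  qed
  moreover have "LE_CN (CCC_graph G) vs = LE_CN_plus (CCC_graph G) vs"
    using LE_CN_eq[OF vs n_pos] LE_CN_plus_eq[OF vs n_pos] by simp
  ultimately show ?thesis
    using a CNL CNSL by blast
qed

end
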